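(* Let $K$ be an arbitrary field, $m,m'\geq 2$, $A\in\mathcal{A}(m)$ and $A'\in\mathcal{A}(m')$. Let $\{1,f_\gamma=x^\gamma u_\gamma\mid\gamma\in\Gamma_A\}$ and $\{1,f'_{\gamma'}=x^{\gamma'}u'_{\gamma'}\mid\gamma'\in\Gamma_{A'}\}$ be the canonical bases of $\overline{A}=A/x^mK[x]$ and $\overline{A'}=A'/x^{m'}K[x]$, respectively. Then: 1. $\operatorname{Iso}_K(A,A')=\{t_\lambda\in\mathbb{T}\mid t_\lambda(A)=A'\}$. 2. $A\simeq A'$ iff $m=m'$, $\Gamma_A=\Gamma_{A'}$ and there exists an automorphism $t_\lambda\in\mathbb{T}$ such that $t_\lambda(f_\gamma)=\lambda^\gamma f'_\gamma$ for all $\gamma\in\Gamma_A$, iff $m=m'$, $\Gamma_A=\Gamma_{A'}$ and there exists an automorphism $t_\lambda\in\mathbb{T}$ such that $t_\lambda(u_\gamma)=u'_\gamma$ for all $\gamma\in\Gamma_A$. 3. Suppose that $A\simeq A'$. Then (a) $\operatorname{Iso}_K(A,A')=\{t_\lambda\in\mathbb{T}\mid t_\lambda(f_\gamma)=\lambda^\gamma f'_\gamma\text{ for all }\gamma\in\Gamma_A=\Gamma_{A'}\}=\{t_\lambda\in\mathbb{T}\mid t_\lambda(u_\gamma)=u'_\gamma\text{ for all }\gamma\in\Gamma_A=\Gamma_{A'}\}$. (b) The $\mathbb{T}$-orbit $\mathbb{T}A$ of the algebra $A$ (i.e. the set of all algebras isomorphic to $A$, by statement 1) is equal to the set $\mathbb{T}/\operatorname{Aut}_K(A)=\{t_\lambda\operatorname{Aut}_K(A)\mid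 t_\lambda\in\mathbb{T}\}$ of all subalgebras of $K[x]$ that are isomorphic to the algebra $A$, where $\operatorname{Aut}_K(A)=\{t_\lambda\in\mathbb{T}\mid t_\lambda(u_\gamma)=u_\gamma\text{ for all }\gamma\in\Gamma_A\}$.
   Context: $\mathcal{A}(m)$ is the set of all $K$-subalgebras $A$ of $K[x]$ such that $x^mK[x]\subset A$ and $x^{m-1}\notin A$. For $A\in\mathcal{A}(m)$, $\Gamma_A$ is the set of integers $\gamma$ with $1\leq\gamma\leq m-1$ such that $A$ contains an element of the form $x^\gamma+\sum_{j>\gamma}\lambda_jx^j$ with $\lambda_j\in K$. With $\Gamma=\Gamma_A$, the algebra $\overline{A}:=A/x^mK[x]\subseteq K[x]/x^mK[x]=\bigoplus_{i=0}^{m-1}Kx^i$ has a unique $K$-basis $\{1,f_\gamma\mid\gamma\in\Gamma\}$ (the canonical basis) with $f_\gamma=x^\gamma+\sum_{\delta\in C\Gamma(\gamma)}\lambda_{\gamma\delta}x^\delta$, $\lambda_{\gamma\delta}\in K$, where $C\Gamma(\gamma)=\{\delta\mid\delta\notin\Gamma,\gamma<\delta\leq m-1\}$. One writes $f_\gamma=x^\gamma u_\gamma$ with $u_\gamma:=1+\sum_{\delta\in C\Gamma(\gamma)}\lambda_{\gamma\delta}x^{\delta-\gamma}$; the elements $f'_{\gamma'}$, $u'_{\gamma'}$ are defined in the same way for $A'$. $\mathbb{T}=\{t_\lambda\mid\lambda\in K^\times\}$ is the algebraic torus, where $t_\lambda$ is the $K$-automorphism of $K[x]$ with $t_\lambda(x)=\lambda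 x$ (it also acts on $K[x]/x^mK[x]$); $\mathbb{T}A=\{t_\lambda(A)\mid\lambda\in K^\times\}$. $\operatorname{Iso}_K(A,A')$ is the set of all $K$-algebra isomorphisms $A\to A'$, and $\operatorname{Aut}_K(A)=\operatorname{Iso}_K(A,A)$; an element $t_\lambda$ with $t_\lambda(A)=A'$ is identified with its restriction $A\to A'$.
   Formalization: In 3(b), "all subalgebras of K[x] isomorphic to A" is read as those lying in some 𝒜(n), n ≥ 2; over all subalgebras the claim is false (K[x^4,x^6] ≅ K[x^2,x^3] but is not in its 𝕋-orbit). *)

theory Defs
  imports "HOL-Computational_Algebra.Polynomial" "HOL-Library.FuncSet"
begin

text \<open>The field \<open>K\<close> is the type \<open>'a\<close> of class \<^class>\<open>field\<close>; \<open>K[x]\<close> is \<open>'a poly\<close>, a vector space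
  over \<open>K\<close> via \<^const>\<open>smult\<close>.\<close>

definition subalgebra :: "'a::field poly set \<Rightarrow> bool" where
  "subalgebra A \<longleftrightarrow>
     module.subspace smult A \<and> 1 \<in> A \<and> (\<forall>p\<in>A. \<forall>q\<in>A. p * q \<in> A)"

definition alg_class :: "nat \<Rightarrow> 'a::field poly set set" where
  "alg_class m = {A. subalgebra A \<and> (\<forall>p. monom 1 m * p \<in> A) \<and> monom 1 (m - 1) \<notin> A}"

definition Gam :: "nat \<Rightarrow> 'a::field poly set \<Rightarrow> nat set" where
  "Gam m A = {\<gamma>. 1 \<le> \<gamma> \<and> \<gamma> \<le> m - 1 \<and> (\<exists>p\<in>A. coeff p \<gamma> = 1 \<and> (\<forall>i<\<gamma>. coeff p i = 0))}"

definition CGam :: "nat \<Rightarrow> 'a::field poly set \<Rightarrow> nat \<Rightarrow> nat set" where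
  "CGam m A \<gamma> = {\<delta>. \<delta> \<notin> Gam m A \<and> \<gamma> < \<delta> \<and> \<delta> \<le> m - 1}"

text \<open>\<open>K[x]/x\<^sup>mK[x]\<close> is identified with the direct sum of the \<open>Kx\<^sup>i\<close>, \<open>i < m\<close>, that is, a residue class
  is represented by its remainder modulo \<open>x\<^sup>m\<close>.\<close>

definition Abar :: "nat \<Rightarrow> 'a::field poly set \<Rightarrow> 'a poly set" where
  "Abar m A = (\<lambda>p. p mod monom 1 m) ` A"

text \<open>The families \<open>f\<close> and \<open>u\<close> are only constrained on \<^term>\<open>Gam m A\<close>.\<close>

definition canonical_basis ::
  "nat \<Rightarrow> 'a::field poly set \<Rightarrow> (nat \<Rightarrow> 'a poly) \<Rightarrow> (nat \<Rightarrow> 'a poly) \<Rightarrow> bool" where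
  "canonical_basis m A f u \<longleftrightarrow>
     (\<exists>lam. \<forall>\<gamma>\<in>Gam m A.
        f \<gamma> = monom 1 \<gamma> + (\<Sum>\<delta>\<in>CGam m A \<gamma>. monom (lam \<gamma> \<delta>) \<delta>) \<and>
        u \<gamma> = 1 + (\<Sum>\<delta>\<in>CGam m A \<gamma>. monom (lam \<gamma> \<delta>) (\<delta> - \<gamma>))) \<and>
     \<not> module.dependent smult (insert 1 (f ` Gam m A)) \<and>
     module.span smult (insert 1 (f ` Gam m A)) = Abar m A"

text \<open>The substitution preserves degrees, so on remainders modulo \<open>x\<^sup>m\<close> it is also the induced
  action on \<open>K[x]/x\<^sup>mK[x]\<close>.\<close>

definition t_aut :: "'a::field \<Rightarrow> 'a poly \<Rightarrow> 'a poly" where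
  "t_aut l p = pcompose p [:0, l:]"

definition torus :: "('a::field poly \<Rightarrow> 'a poly) set" where
  "torus = {t_aut l | l. l \<noteq> 0}"

definition torus_orbit :: "'a::field poly set \<Rightarrow> 'a poly set set" where
  "torus_orbit A = {t_aut l ` A | l. l \<noteq> 0}"

text \<open>A map with domain \<open>A\<close> is a HOL function that is undefined outside \<open>A\<close>.\<close>

definition Iso_K :: "'a::field poly set \<Rightarrow> 'a poly set \<Rightarrow> ('a poly \<Rightarrow> 'a poly) set" where
  "Iso_K A B = {\<phi> \<in> extensional A. bij_betw \<phi> A B \<and> \<phi> 1 = 1 \<and>
     (\<forall>p\<in>A. \<forall>q\<in>A. \<phi> (p + q) = \<phi> p + \<phi> q \<and> \<phi> (p * q) = \<phi> p * \<phi> q) \<and>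
     (\<forall>c. \<forall>p\<in>A. \<phi> (smult c p) = smult c (\<phi> p))}"

abbreviation Aut_K :: "'a::field poly set \<Rightarrow> ('a poly \<Rightarrow> 'a poly) set" where
  "Aut_K A \<equiv> Iso_K A A"

definition alg_iso :: "'a::field poly set \<Rightarrow> 'a poly set \<Rightarrow> bool" where
  "alg_iso A B \<longleftrightarrow> Iso_K A B \<noteq> {}"

text \<open>\<open>Aut\<^sub>K(A)\<close> as a subset of the torus, a torus element being identified with its restriction
  to \<open>A\<close>; then its left cosets and the coset space.\<close>

definition torus_Aut :: "'a::field poly set \<Rightarrow> ('a poly \<Rightarrow> 'a poly) set" where
  "torus_Aut A = {t \<in> torus. restrict t A \<in> Aut_K A}"

definition torus_coset :: "'a::field \<Rightarrow> 'a poly set \<Rightarrow> ('a poly \<Rightarrow> 'a poly) set" where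
  "torus_coset l A = {t_aut l \<circ> s | s. s \<in> torus_Aut A}"

definition torus_mod_Aut :: "'a::field poly set \<Rightarrow> ('a poly \<Rightarrow> 'a poly) set set" where
  "torus_mod_Aut A = {torus_coset l A | l. l \<noteq> 0}"

end

theory Submission imports Defs begin

text \<open>Let \<open>\<phi> : A \<rightarrow> A'\<close> be an isomorphism, \<open>p = \<phi>(x\<^sup>m)\<close> and \<open>q = \<phi>(x\<^bsup>m+1\<^esup>)\<close>. Every
  \<open>p (q/p)\<^sup>k = \<phi>(x\<^bsup>m+k\<^esup>)\<close> is a polynomial, so \<open>q/p\<close> is almost integral over \<open>K[x]\<close> and hence is a
  polynomial \<open>y\<close>; then \<open>p = y\<^sup>m\<close>, and \<open>\<phi>\<close> is the substitution \<open>a \<mapsto> a(y)\<close>. Since \<open>A'\<close> contains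
  polynomials of the coprime degrees \<open>m'\<close> and \<open>m' + 1\<close>, \<open>y\<close> has degree one, so \<open>\<phi>\<close> carries the
  conductor \<open>x\<^sup>mK[x]\<close> of \<open>A\<close> to the conductor \<open>x\<^bsup>m'\<^esup>K[x]\<close> of \<open>A'\<close>, which forces \<open>y(0) = 0\<close>. The
  descriptions by canonical bases follow because a nonzero element of \<open>A'\<close> of order below \<open>m'\<close>
  has its order in \<open>\<Gamma>\<close> (or equal to zero), so canonical bases are unique.\<close>

interpretation poly_vs: vector_space "smult :: 'a::field \<Rightarrow> 'a poly \<Rightarrow> 'a poly"
  by unfold_locales (simp_all add: smult_add_left smult_add_right)

section \<open>The torus action\<close>

lemma coeff_t_aut [simp]: "coeff (t_aut l p) i = l ^ i * coeff p i"
proof (induction p arbitrary: i)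
  case 0
  then show ?case by (simp add: t_aut_def)
next
  case (pCons a p)
  then show ?case
    by (cases i) (simp_all add: t_aut_def pcompose_pCons algebra_simps coeff_pCons split: nat.split)
qed

lemma t_aut_add: "t_aut l (p + q) = t_aut l p + t_aut l q"
  and t_aut_mult: "t_aut l (p * q) = t_aut l p * t_aut l q"
  and t_aut_smult: "t_aut l (smult c p) = smult c (t_aut l p)"
  and t_aut_1 [simp]: "t_aut l 1 = 1"
  by (simp_all add: t_aut_def pcompose_add pcompose_mult pcompose_smult pcompose_1)

lemma t_aut_0 [simp]: "t_aut l 0 = 0"
  by (simp add: t_aut_def)

lemma t_aut_monom: "t_aut l (monom c n) = monom (l ^ n * c) n"
  by (rule poly_eqI) simp

lemma t_aut_t_aut: "t_aut l (t_aut k p) = t_aut (l * k) p"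
  by (rule poly_eqI) (simp add: power_mult_distrib)

lemma t_aut_one [simp]: "t_aut 1 p = p"
  by (rule poly_eqI) simp

lemma t_aut_inverse [simp]:
  assumes "l \<noteq> 0"
  shows "t_aut (inverse l) (t_aut l p) = p" "t_aut l (t_aut (inverse l) p) = p"
  using assms by (simp_all add: t_aut_t_aut)

lemma inj_t_aut: "l \<noteq> 0 \<Longrightarrow> inj_on (t_aut l) A"
  by (metis inj_onI t_aut_inverse(1))

lemma image_t_aut_image: "t_aut l ` t_aut k ` A = t_aut (l * k) ` A"
  by (simp add: image_image t_aut_t_aut)

lemma image_t_aut_eq_iff:
  assumes "l \<noteq> 0"
  shows "t_aut l ` A = B \<longleftrightarrow> A = t_aut (inverse l) ` B"
proof -
  have "t_aut l ` t_aut (inverse l) ` B = B" "t_aut (inverse l) ` t_aut l ` A = A"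
    using assms by (simp_all add: image_image)
  then show ?thesis by metis
qed

section \<open>Subalgebras with conductor generated by a power of the variable\<close>

lemma subalgebraD:
  assumes "subalgebra A"
  shows "0 \<in> A" "1 \<in> A" "p \<in> A \<Longrightarrow> q \<in> A \<Longrightarrow> p + q \<in> A" "p \<in> A \<Longrightarrow> q \<in> A \<Longrightarrow> p - q \<in> A"
    "p \<in> A \<Longrightarrow> q \<in> A \<Longrightarrow> p * q \<in> A" "p \<in> A \<Longrightarrow> smult c p \<in> A"
  using assms poly_vs.subspace_diff
  by (auto simp: subalgebra_def poly_vs.subspace_def)

lemma alg_class_subalgebra: "A \<in> alg_class m \<Longrightarrow> subalgebra A"
  by (simp add: alg_class_def)

lemma alg_class_dvd: "A \<in> alg_class m \<Longrightarrow> monom 1 m dvd p \<Longrightarrow> p \<in> A"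
  by (auto simp: alg_class_def dvd_def)

lemma alg_class_monom: "A \<in> alg_class m \<Longrightarrow> m \<le> n \<Longrightarrow> monom c n \<in> A"
  by (rule alg_class_dvd) (auto simp: monom_1_dvd_iff')

text \<open>For \<open>m = 0\<close> truncated subtraction makes the excluded monomial equal to 1,
  which lies in every subalgebra.\<close>

lemma alg_class_pos: "A \<in> alg_class m \<Longrightarrow> 0 < m"
  by (cases m) (auto simp: alg_class_def subalgebra_def)

text \<open>The number \<open>m - 1\<close> is the largest exponent of a power of x outside
  \<open>A\<close>, so \<open>m\<close> is an invariant of \<open>A\<close>.\<close>

lemma alg_class_unique:
  assumes "A \<in> alg_class m" "A \<in> alg_class n"
  shows "m = n"
proof -
  have "k \<le> j" if "A \<in> alg_class j" "A \<in> alg_class k" for j k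
    using alg_class_monom[OF that(1), of "k - 1" 1] alg_class_pos[OF that(2)] that(2)
    by (fastforce simp: alg_class_def)
  with assms show ?thesis by (meson le_antisym)
qed

lemma subalgebra_image_t_aut:
  assumes "subalgebra A"
  shows "subalgebra (t_aut l ` A)"
proof -
  note A = subalgebraD[OF assms]
  have "0 \<in> t_aut l ` A" "1 \<in> t_aut l ` A"
    using A(1,2) by (metis image_eqI t_aut_0, metis image_eqI t_aut_1)
  moreover have "t_aut l p + t_aut l q \<in> t_aut l ` A" "t_aut l p * t_aut l q \<in> t_aut l ` A"
    "smult c (t_aut l p) \<in> t_aut l ` A" if "p \<in> A" "q \<in> A" for p q c
    using A that by (metis image_eqI t_aut_add, metis image_eqI t_aut_mult, metis image_eqI t_aut_smult)
  ultimately show ?thesis by (auto simp: subalgebra_def poly_vs.subspace_def)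
qed

lemma alg_class_image_t_aut:
  assumes A: "A \<in> alg_class m" and l: "l \<noteq> 0"
  shows "t_aut l ` A \<in> alg_class m"
proof -
  have "monom 1 m * p \<in> t_aut l ` A" for p
  proof
    show "monom 1 m * p = t_aut l (t_aut (inverse l) (monom 1 m * p))"
      using l by simp
    show "t_aut (inverse l) (monom 1 m * p) \<in> A"
      by (rule alg_class_dvd[OF A]) (simp add: monom_1_dvd_iff' coeff_monom_mult)
  qed
  moreover have "monom 1 (m - 1) \<notin> t_aut l ` A"
  proof
    assume "monom 1 (m - 1) \<in> t_aut l ` A"
    then obtain p where p: "p \<in> A" "monom 1 (m - 1) = t_aut l p" by auto
    then have "p = t_aut (inverse l) (monom 1 (m - 1))" using l by simp
    then have "smult (l ^ (m - 1)) p = monom 1 (m - 1)"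
      using l by (simp add: t_aut_monom smult_monom power_inverse)
    then have "monom 1 (m - 1) \<in> A"
      using subalgebraD(6)[OF alg_class_subalgebra[OF A] p(1)] by metis
    with A show False by (simp add: alg_class_def)
  qed
  ultimately show ?thesis
    using subalgebra_image_t_aut[OF alg_class_subalgebra[OF A]] by (simp add: alg_class_def)
qed

text \<open>This identifies the conductor of \<open>A\<close> in K[x] as exactly the ideal generated
  by x^m. If the order k of \<open>h\<close> were below m, a multiple of \<open>h\<close> would have
  order m - 1, and removing its part divisible by x^m would put x^(m-1) into
  \<open>A\<close>.\<close>

lemma conductor_dvd:
  assumes A: "A \<in> alg_class m" and h: "\<And>g. h * g \<in> A"
  shows "monom 1 m dvd h"
proof (rule ccontr)
  assume "\<not> monom 1 m dvd h"
  then obtain j where j: "j < m" "coeff h j \<noteq> 0" by (auto simp: monom_1_dvd_iff')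
  define k where "k = (LEAST k. coeff h k \<noteq> 0)"
  have k: "coeff h k \<noteq> 0" "\<And>i. i < k \<Longrightarrow> coeff h i = 0"
    unfolding k_def using LeastI[of "\<lambda>k. coeff h k \<noteq> 0", OF j(2)] not_less_Least by auto
  have "k \<le> j" unfolding k_def using j(2) by (rule Least_le)
  with j have km: "k < m" by simp
  \<comment> \<open>The shift raises the order from k to exactly m - 1, so that \<open>r\<close>
    agrees with its lowest term modulo x^m.\<close>
  define r where "r = monom 1 (m - 1 - k) * h"
  have "r \<in> A" unfolding r_def using h[of "monom 1 (m - 1 - k)"] by (simp add: mult.commute)
  moreover have "r - monom (coeff h k) (m - 1) \<in> A"
    by (rule alg_class_dvd[OF A]) (use k km in \<open>auto simp: monom_1_dvd_iff' r_def coeff_monom_mult\<close>)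
  ultimately have "r - (r - monom (coeff h k) (m - 1)) \<in> A"
    by (rule subalgebraD(4)[OF alg_class_subalgebra[OF A]])
  then have "smult (inverse (coeff h k)) (monom (coeff h k) (m - 1)) \<in> A"
    using subalgebraD(6)[OF alg_class_subalgebra[OF A]] by simp
  with k(1) A show False by (simp add: smult_monom alg_class_def)
qed

section \<open>Isomorphisms are restrictions of torus elements\<close>

text \<open>K[x] is completely integrally closed: if all powers of q/p have the common denominator
  \<open>h\<close>, then q/p is a polynomial. The argument uses division with remainder instead of
  factorization.\<close>

lemma dvd_if_power_dvd_mult_power:
  fixes p q h :: "'a::field poly"
  assumes "h \<noteq> 0" and "\<And>k. p ^ k dvd h * q ^ k"
  shows "p dvd q"
proof (cases "p = 0")
  case True
  then show ?thesis using assms(1) assms(2)[of 1] by simp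
next
  case False
  \<comment> \<open>\<open>J\<close> is the ideal of common denominators of all powers of q/p. It
    contains \<open>h\<close>, hence a nonzero element \<open>g\<close> of least degree.\<close>
  define J where "J = {g. \<forall>k. p ^ k dvd g * q ^ k}"
  obtain g where g: "g \<in> J" "g \<noteq> 0" and g_min: "\<And>g'. g' \<in> J \<Longrightarrow> g' \<noteq> 0 \<Longrightarrow> degree g \<le> degree g'"
    using ex_has_least_nat[of "\<lambda>g. g \<in> J \<and> g \<noteq> 0" h degree] assms by (auto simp: J_def)
  from g(1) have "p ^ 1 dvd g * q ^ 1" unfolding J_def by blast
  then obtain w where w: "g * q = p * w" by (auto simp: dvd_def)
  txt \<open>The ideal \<open>J\<close> is generated by \<open>g\<close> and stable under multiplication by \<open>q/p\<close>.\<close>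
  have "p ^ k dvd w * q ^ k" for k
  proof -
    have "p ^ Suc k dvd g * q ^ Suc k" using g(1) unfolding J_def by blast
    also have "g * q ^ Suc k = p * (w * q ^ k)" using w by (metis mult.assoc power_Suc)
    finally show ?thesis using False by simp
  qed
  moreover have "p ^ k dvd (w div g) * (g * q ^ k)" for k
    using g(1) by (simp add: J_def)
  moreover have "(w mod g) * q ^ k = w * q ^ k - (w div g) * (g * q ^ k)" for k
    by (simp add: minus_div_mult_eq_mod[symmetric] left_diff_distrib mult.assoc)
  ultimately have "w mod g \<in> J"
    by (simp add: J_def dvd_diff)
  \<comment> \<open>A nonzero remainder would be an element of \<open>J\<close> of degree smaller
    than that of \<open>g\<close>.\<close>
  then have "w mod g = 0"
    using g_min degree_mod_less'[of g w] g(2) by fastforce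
  then obtain y where "w = g * y" by (auto simp: mod_eq_0_iff_dvd dvd_def)
  with w g(2) have "q = p * y" by simp
  then show ?thesis by simp
qed

lemma Iso_KD:
  assumes "\<phi> \<in> Iso_K A B"
  shows "\<phi> \<in> extensional A" "inj_on \<phi> A" "\<phi> ` A = B" "\<phi> 1 = 1"
    "p \<in> A \<Longrightarrow> q \<in> A \<Longrightarrow> \<phi> (p + q) = \<phi> p + \<phi> q"
    "p \<in> A \<Longrightarrow> q \<in> A \<Longrightarrow> \<phi> (p * q) = \<phi> p * \<phi> q"
    "p \<in> A \<Longrightarrow> \<phi> (smult c p) = smult c (\<phi> p)"
  using assms by (auto simp: Iso_K_def bij_betw_def)

lemma Iso_K_power:
  assumes "\<phi> \<in> Iso_K A B" "subalgebra A" "p \<in> A"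
  shows "p ^ k \<in> A \<and> \<phi> (p ^ k) = \<phi> p ^ k"
  using Iso_KD[OF assms(1)] subalgebraD[OF assms(2)] assms(3) by (induction k) auto

lemma Iso_K_pcompose:
  assumes A: "A \<in> alg_class m" and iso: "\<phi> \<in> Iso_K A B"
  shows "\<exists>y. \<forall>a\<in>A. \<phi> a = pcompose a y"
proof -
  note sub = subalgebraD[OF alg_class_subalgebra[OF A]] and \<phi> = Iso_KD[OF iso]
    and pow = Iso_K_power[OF iso alg_class_subalgebra[OF A]]
  have mem: "monom c n \<in> A" if "m \<le> n" for c n using alg_class_monom[OF A that] .
  define p q where "p = \<phi> (monom 1 m)" and "q = \<phi> (monom 1 (m + 1))"
  have \<phi>0: "\<phi> 0 = 0" using \<phi>(7)[of 0 0] sub(1) by simp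
  have p0: "p \<noteq> 0"
    unfolding p_def using \<phi>0 \<phi>(2) mem[of m 1] sub(1)
    by (metis inj_onD monom_eq_0_iff order_refl zero_neq_one)
  have pk: "\<phi> (monom 1 (m * k)) = p ^ k" and qk: "\<phi> (monom 1 ((m + 1) * k)) = q ^ k" for k
    using pow[of "monom 1 m" k] pow[of "monom 1 (m + 1)" k] mem[of m 1] mem[of "m + 1" 1]
    by (simp_all add: p_def q_def monom_power)
  \<comment> \<open>Multiplicativity is available only on \<open>A\<close>, and exponents from m on
    guarantee membership.\<close>
  have mul: "\<phi> (monom 1 (i + j)) = \<phi> (monom 1 i) * \<phi> (monom 1 j)" if "m \<le> i" "m \<le> j" for i j
    using \<phi>(6)[of "monom 1 i" "monom 1 j"] mem that by (simp add: mult_monom)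
  \<comment> \<open>The common denominator is \<open>p\<close> itself: x^m (x^(m+1))^k = (x^m)^k
    x^(m+k), with both factors on the right in the conductor. The case k = 0 is apart because
    \<open>mul\<close> needs m \<le> m * k.\<close>
  have "p ^ k dvd p * q ^ k" for k
  proof (cases k)
    case (Suc k')
    then have "p * q ^ k = \<phi> (monom 1 (m + (m + 1) * k))"
      using mul[of m "(m + 1) * k"] by (simp only: p_def qk) simp
    also have "m + (m + 1) * k = m * k + (m + k)" by simp
    also have "\<phi> (monom 1 \<dots>) = p ^ k * \<phi> (monom 1 (m + k))"
      using mul[of "m * k" "m + k"] Suc by (simp only: pk) simp
    finally show ?thesis by simp
  qed simp
  from dvd_if_power_dvd_mult_power[OF p0 this] obtain y where y: "q = p * y" by (auto simp: dvd_def)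
  \<comment> \<open>Both sides are the image of x^(m(m+1)). Substituting q = p y and cancelling p^m
    leaves p = y^m.\<close>
  have "q ^ m = p ^ (m + 1)" by (metis pk qk mult.commute)
  then have p_eq: "p = y ^ m" using y p0 by (simp add: power_mult_distrib)
  have monom: "\<phi> (monom 1 (m + k)) = y ^ (m + k)" for k
  proof (induction k)
    case 0
    then show ?case by (simp add: p_eq flip: p_def)
  next
    case (Suc k)
    \<comment> \<open>Both products are the image of x^(2m+k+1). Cancelling \<open>p\<close> shows
      that raising the exponent by one multiplies the image by \<open>y\<close>.\<close>
    have "p * \<phi> (monom 1 (m + Suc k)) = q * \<phi> (monom 1 (m + k))"
      using mul[of m "m + Suc k"] mul[of "m + 1" "m + k"] by (simp add: p_def q_def)
    with Suc y p0 show ?case by simp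
  qed
  \<comment> \<open>The exponent n is generalized because x^n (a + x g) = a x^n + x^(n+1) g, which
    splits the argument inside the conductor.\<close>
  have shift: "\<phi> (monom 1 n * g) = y ^ n * pcompose g y" if "m \<le> n" for n g
    using that
  proof (induction g arbitrary: n)
    case 0
    then show ?case by (simp add: \<phi>0)
  next
    case (pCons a g)
    have "monom 1 n * pCons a g = smult a (monom 1 n) + monom 1 (Suc n) * g"
      by (rule poly_eqI) (auto simp: coeff_monom_mult coeff_pCons Suc_diff_Suc split: nat.split)
    moreover have "smult a (monom 1 n) \<in> A" "monom 1 (Suc n) * g \<in> A"
      using mem pCons.prems by (auto simp: smult_monom monom_1_dvd_iff' coeff_monom_mult
          intro: alg_class_dvd[OF A])
    ultimately show ?case
      using \<phi>(5,7) mem pCons.prems pCons.IH[of "Suc n"] monom[of "n - m"]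
      by (simp add: pcompose_pCons algebra_simps)
  qed
  have "\<phi> a = pcompose a y" if "a \<in> A" for a
  proof -
    \<comment> \<open>Multiplication by x^m moves an arbitrary \<open>a\<close> into the conductor,
      where \<open>shift\<close> applies; its image \<open>p\<close> is then cancelled.\<close>
    have "p * \<phi> a = \<phi> (monom 1 m * a)" using \<phi>(6)[of "monom 1 m" a] mem that by (simp add: p_def)
    also have "\<dots> = p * pcompose a y" using shift[of m a] p_eq by simp
    finally show ?thesis using p0 by simp
  qed
  then show ?thesis by blast
qed

lemma pcompose_monom: "pcompose (monom 1 n) y = y ^ n"
  by (induction n) (simp_all add: monom_Suc pcompose_pCons pcompose_1)

lemma Iso_K_torus:
  assumes A: "A \<in> alg_class m" and B: "B \<in> alg_class n" and iso: "\<phi> \<in> Iso_K A B"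
  obtains c where "c \<noteq> 0" "t_aut c ` A = B" "\<phi> = restrict (t_aut c) A"
proof -
  obtain y where y: "\<And>a. a \<in> A \<Longrightarrow> \<phi> a = pcompose a y"
    using Iso_K_pcompose[OF A iso] by blast
  \<comment> \<open>By surjectivity x^k has the form a(y), whose degree is a multiple of that of
    \<open>y\<close>. The consecutive exponents n and n + 1 then force degree one.\<close>
  have deg: "degree y dvd k" if "n \<le> k" for k
  proof -
    have "monom 1 k \<in> \<phi> ` A" using Iso_KD(3)[OF iso] alg_class_monom[OF B that] by simp
    then obtain a where "monom 1 k = pcompose a y" using y by auto
    then have "degree (monom 1 k :: 'a poly) = degree a * degree y" by (metis degree_pcompose)
    then show ?thesis by (simp add: degree_monom_eq)
  qed
  have "degree y = 1" using deg[of n] deg[of "n + 1"] by (metis dvd_add_right_iff le_add1 nat_dvd_1_iff_1 order_refl)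
  then obtain b c where bc: "y = [:b, c:]" "c \<noteq> 0"
    by (metis degree1_coeffs)
  \<comment> \<open>\<open>z\<close> is the compositional inverse of \<open>y\<close>, so every
    polynomial \<open>g\<close> is a substitution of \<open>y\<close> into some polynomial.\<close>
  define z where "z = [:- b / c, 1 / c:]"
  have zy: "pcompose z y = [:0, 1:]"
    using bc by (simp add: z_def pcompose_pCons)
  have "y ^ m * g \<in> B" for g
  proof -
    have "y ^ m * g = pcompose (monom 1 m * pcompose g z) y"
      by (simp add: pcompose_mult pcompose_assoc[symmetric] zy pcompose_monom)
    also have "\<dots> = \<phi> (monom 1 m * pcompose g z)"
      by (rule y[symmetric]) (simp add: alg_class_dvd[OF A])
    also have "\<dots> \<in> B"
      using Iso_KD(3)[OF iso] alg_class_dvd[OF A] by auto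
    finally show ?thesis .
  qed
  then have "monom 1 n dvd y ^ m" by (rule conductor_dvd[OF B])
  \<comment> \<open>Here n > 0 matters: x divides y^m, whose constant coefficient is b^m.\<close>
  then have "coeff (y ^ m) 0 = 0"
    using alg_class_pos[OF B] by (simp add: monom_1_dvd_iff')
  then have "b = 0" using bc by (simp add: coeff_0_power)
  then have "\<phi> a = t_aut c a" if "a \<in> A" for a
    using y[OF that] bc by (simp add: t_aut_def)
  then have "t_aut c ` A = \<phi> ` A" and "\<phi> = restrict (t_aut c) A"
    using Iso_KD(1)[OF iso] by (auto simp: fun_eq_iff extensional_def)
  then show ?thesis using that bc(2) Iso_KD(3)[OF iso] by simp
qed

lemma restrict_t_aut_Iso_K:
  assumes "subalgebra A" "l \<noteq> 0"
  shows "restrict (t_aut l) A \<in> Iso_K A (t_aut l ` A)"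
  using subalgebraD[OF assms(1)] inj_t_aut[OF assms(2), of A]
  by (simp add: Iso_K_def bij_betw_def t_aut_add t_aut_mult t_aut_smult)

lemma alg_iso_iff_torus:
  assumes "A \<in> alg_class m" "B \<in> alg_class n"
  shows "alg_iso A B \<longleftrightarrow> (\<exists>l. l \<noteq> 0 \<and> t_aut l ` A = B)"
proof
  assume "alg_iso A B"
  then obtain \<phi> where "\<phi> \<in> Iso_K A B" by (auto simp: alg_iso_def)
  with assms obtain l where "l \<noteq> 0" "t_aut l ` A = B" by (rule Iso_K_torus)
  then show "\<exists>l. l \<noteq> 0 \<and> t_aut l ` A = B" by blast
next
  assume "\<exists>l. l \<noteq> 0 \<and> t_aut l ` A = B"
  then show "alg_iso A B"
    using restrict_t_aut_Iso_K[OF alg_class_subalgebra[OF assms(1)]] by (auto simp: alg_iso_def)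
qed

text \<open>This justifies identifying a torus element with its restriction: x^m and x^(m+1) lie in
  \<open>A\<close>, and the powers \<lambda>^m and \<lambda>^(m+1) determine a nonzero
  \<lambda>.\<close>

lemma inj_on_restrict_torus:
  assumes A: "A \<in> alg_class m"
  shows "inj_on (\<lambda>t. restrict t A) torus"
proof (rule inj_onI)
  fix s t assume "s \<in> torus" "t \<in> torus" and eq: "restrict s A = restrict t A"
  then obtain k l where kl: "k \<noteq> 0" "l \<noteq> 0" "s = t_aut k" "t = t_aut l" by (auto simp: torus_def)
  have "k ^ n = l ^ n" if "m \<le> n" for n
  proof -
    have "s (monom 1 n) = t (monom 1 n)"
      using alg_class_monom[OF A that] eq by (metis restrict_apply')
    then show ?thesis by (simp add: kl t_aut_monom)
  qed
  from this[of m] this[of "Suc m"] kl show "s = t" by simp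
qed

lemma bij_betw_restrict_Iso_K:
  assumes "A \<in> alg_class m" "B \<in> alg_class n"
  shows "bij_betw (\<lambda>t. restrict t A) {t \<in> torus. t ` A = B} (Iso_K A B)"
  unfolding bij_betw_def
proof
  show "inj_on (\<lambda>t. restrict t A) {t \<in> torus. t ` A = B}"
    by (rule inj_on_subset[OF inj_on_restrict_torus[OF assms(1)]]) auto
  show "(\<lambda>t. restrict t A) ` {t \<in> torus. t ` A = B} = Iso_K A B"
  proof (intro equalityI subsetI)
    fix \<phi> assume "\<phi> \<in> Iso_K A B"
    from assms this obtain c where "c \<noteq> 0" "t_aut c ` A = B" "\<phi> = restrict (t_aut c) A"
      by (rule Iso_K_torus)
    then show "\<phi> \<in> (\<lambda>t. restrict t A) ` {t \<in> torus. t ` A = B}"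
      unfolding torus_def by blast
  qed (auto simp: torus_def intro: restrict_t_aut_Iso_K[OF alg_class_subalgebra[OF assms(1)]])
qed

lemma torus_Aut_eq:
  assumes "A \<in> alg_class m"
  shows "torus_Aut A = {t \<in> torus. t ` A = A}"
  using bij_betw_imp_surj_on[OF bij_betw_restrict_Iso_K[OF assms assms]]
proof -
  have "restrict t A \<in> Aut_K A \<longleftrightarrow> t ` A = A" if t: "t \<in> torus" for t
  proof
    assume "restrict t A \<in> Aut_K A"
    from Iso_KD(3)[OF this] show "t ` A = A" by simp
  next
    assume "t ` A = A"
    moreover obtain l where "l \<noteq> 0" "t = t_aut l" using t by (auto simp: torus_def)
    ultimately show "restrict t A \<in> Aut_K A"
      using restrict_t_aut_Iso_K[OF alg_class_subalgebra[OF assms], of l] by simp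
  qed
  then show ?thesis by (auto simp: torus_Aut_def)
qed

section \<open>Canonical bases\<close>

text \<open>Over a field the lowest coefficient can be scaled to 1, so \<Gamma> consists of the
  orders between 1 and m - 1 of elements of \<open>A\<close>.\<close>

lemma Gam_if_coeff:
  assumes "subalgebra A" "p \<in> A" "coeff p \<gamma> \<noteq> 0" "\<And>i. i < \<gamma> \<Longrightarrow> coeff p i = 0" "1 \<le> \<gamma>" "\<gamma> \<le> m - 1"
  shows "\<gamma> \<in> Gam m A"
proof -
  have "smult (inverse (coeff p \<gamma>)) p \<in> A" by (rule subalgebraD(6)[OF assms(1,2)])
  then show ?thesis using assms(3-6)
    by (auto simp: Gam_def intro!: bexI[of _ "smult (inverse (coeff p \<gamma>)) p"])
qed

lemma Gam_image_t_aut: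
  fixes l :: "'a::field"
  assumes l: "l \<noteq> 0" and A: "subalgebra A"
  shows "Gam m (t_aut l ` A) = Gam m A"
proof -
  \<comment> \<open>A torus element preserves orders. Stating the inclusion for all \<open>k\<close>
    and \<open>B\<close> lets the inverse element supply the other inclusion.\<close>
  have sub: "Gam m B \<subseteq> Gam m (t_aut k ` B)" if k: "k \<noteq> 0" and B: "subalgebra B"
    for k :: 'a and B
  proof
    fix \<gamma> assume "\<gamma> \<in> Gam m B"
    then obtain p where p: "1 \<le> \<gamma>" "\<gamma> \<le> m - 1" "p \<in> B" "coeff p \<gamma> = 1" "\<And>i. i < \<gamma> \<Longrightarrow> coeff p i = 0"
      by (auto simp: Gam_def)
    then show "\<gamma> \<in> Gam m (t_aut k ` B)"
      using k by (intro Gam_if_coeff[OF subalgebra_image_t_aut[OF B], of "t_aut k p"]) auto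
  qed
  have "t_aut (inverse l) ` t_aut l ` A = A" using l by (simp add: image_image)
  then show ?thesis
    using sub[OF l A] sub[of "inverse l" "t_aut l ` A"] l subalgebra_image_t_aut[OF A] by fastforce
qed

text \<open>This is the source of uniqueness of canonical bases: the order of a nonzero
  \<open>d\<close> would be both a gap and a member of \<Gamma>.\<close>

lemma eq_0_if_support_subset_CGam:
  assumes A: "subalgebra A" and d: "d \<in> A" and supp: "\<And>i. coeff d i \<noteq> 0 \<Longrightarrow> i \<in> CGam m A \<gamma>"
  shows "d = 0"
proof (rule ccontr)
  assume "d \<noteq> 0"
  then obtain j where j: "coeff d j \<noteq> 0" by (auto simp: poly_eq_iff)
  define k where "k = (LEAST k. coeff d k \<noteq> 0)"
  have k: "coeff d k \<noteq> 0" "\<And>i. i < k \<Longrightarrow> coeff d i = 0"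
    unfolding k_def using LeastI[of "\<lambda>k. coeff d k \<noteq> 0", OF j] not_less_Least by auto
  then have "k \<in> CGam m A \<gamma>" using supp by blast
  then show False using Gam_if_coeff[OF A d k] by (auto simp: CGam_def)
qed

lemma canonical_basis_span:
  "canonical_basis m A f u \<Longrightarrow> poly_vs.span (insert 1 (f ` Gam m A)) = Abar m A"
  by (auto simp: canonical_basis_def)

lemma canonical_basis_f_u:
  assumes "canonical_basis m A f u" and "\<gamma> \<in> Gam m A"
  shows "f \<gamma> = monom 1 \<gamma> * u \<gamma>"
proof -
  obtain lam where "f \<gamma> = monom 1 \<gamma> + (\<Sum>\<delta>\<in>CGam m A \<gamma>. monom (lam \<gamma> \<delta>) \<delta>)"
    "u \<gamma> = 1 + (\<Sum>\<delta>\<in>CGam m A \<gamma>. monom (lam \<gamma> \<delta>) (\<delta> - \<gamma>))"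
    using assms unfolding canonical_basis_def by blast
  moreover have "monom 1 \<gamma> * (\<Sum>\<delta>\<in>CGam m A \<gamma>. monom (lam \<gamma> \<delta>) (\<delta> - \<gamma>))
      = (\<Sum>\<delta>\<in>CGam m A \<gamma>. monom (lam \<gamma> \<delta>) \<delta>)"
    unfolding sum_distrib_left by (rule sum.cong) (auto simp: mult_monom CGam_def)
  ultimately show ?thesis by (simp add: distrib_left)
qed

lemma canonical_basis_coeff:
  assumes "canonical_basis m A f u" and "\<gamma> \<in> Gam m A" and "i \<notin> CGam m A \<gamma>"
  shows "coeff (f \<gamma>) i = (if i = \<gamma> then 1 else 0)"
proof -
  obtain lam where "f \<gamma> = monom 1 \<gamma> + (\<Sum>\<delta>\<in>CGam m A \<gamma>. monom (lam \<gamma> \<delta>) \<delta>)"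
    using assms unfolding canonical_basis_def by blast
  moreover have "(\<Sum>\<delta>\<in>CGam m A \<gamma>. coeff (monom (lam \<gamma> \<delta>) \<delta>) i) = 0"
    using assms(3) by (intro sum.neutral) auto
  ultimately show ?thesis by (simp add: coeff_sum)
qed

text \<open>Since \<open>A\<close> contains all multiples of x^m, membership depends only on the
  remainder, which lets elements of \<open>Abar m A\<close> be treated as elements of
  \<open>A\<close>.\<close>

lemma mod_monom_mem_iff:
  assumes "A \<in> alg_class m"
  shows "p mod monom 1 m \<in> A \<longleftrightarrow> p \<in> A"
proof -
  note A = subalgebraD[OF alg_class_subalgebra[OF assms]]
  have q: "monom 1 m * (p div monom 1 m) \<in> A" by (rule alg_class_dvd[OF assms]) simp
  have "p mod monom 1 m + monom 1 m * (p div monom 1 m) = p"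
    "p - monom 1 m * (p div monom 1 m) = p mod monom 1 m"
    by (simp_all add: minus_mult_div_eq_mod)
  then show ?thesis using A(3,4)[OF _ q] by metis
qed

lemma canonical_basis_mem:
  assumes A: "A \<in> alg_class m" and "canonical_basis m A f u" and "\<gamma> \<in> Gam m A"
  shows "f \<gamma> \<in> A"
proof -
  have "f \<gamma> \<in> Abar m A"
    using poly_vs.span_base[of "f \<gamma>" "insert 1 (f ` Gam m A)"] assms(3)
    by (simp add: canonical_basis_span[OF assms(2)])
  then show ?thesis by (auto simp: Abar_def mod_monom_mem_iff[OF A])
qed

text \<open>An element of \<open>A\<close> is a combination of 1 and the \<open>f \<gamma>\<close>
  plus a multiple of x^m. Torus elements fix 1 and preserve divisibility by x^m, so only the
  \<open>f \<gamma>\<close> need checking.\<close>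

lemma image_t_aut_subset:
  assumes A: "A \<in> alg_class m" and B: "B \<in> alg_class m" and basis: "canonical_basis m A f u"
    and mem: "\<And>\<gamma>. \<gamma> \<in> Gam m A \<Longrightarrow> t_aut l (f \<gamma>) \<in> B"
  shows "t_aut l ` A \<subseteq> B"
proof
  note sub = subalgebraD[OF alg_class_subalgebra[OF B]]
  fix q assume "q \<in> t_aut l ` A"
  then obtain p where p: "p \<in> A" "q = t_aut l p" by auto
  have "poly_vs.subspace {s. t_aut l s \<in> B}"
    using sub by (auto simp: poly_vs.subspace_def t_aut_add t_aut_smult)
  then have "poly_vs.span (insert 1 (f ` Gam m A)) \<subseteq> {s. t_aut l s \<in> B}"
    using mem sub(2) by (intro poly_vs.span_minimal) auto
  with p(1) have "t_aut l (p mod monom 1 m) \<in> B"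
    by (auto simp: canonical_basis_span[OF basis] Abar_def)
  moreover have "t_aut l (monom 1 m * (p div monom 1 m)) \<in> B"
    by (rule alg_class_dvd[OF B]) (simp add: monom_1_dvd_iff' coeff_monom_mult)
  ultimately have "t_aut l (p mod monom 1 m + monom 1 m * (p div monom 1 m)) \<in> B"
    unfolding t_aut_add by (rule sub(3))
  then show "q \<in> B" by (simp add: p(2))
qed

lemma image_t_aut_eq_iff_canonical_basis:
  assumes A: "A \<in> alg_class m" and B: "B \<in> alg_class n"
    and bA: "canonical_basis m A f u" and bB: "canonical_basis n B f' u'" and l: "l \<noteq> 0"
  shows "t_aut l ` A = B \<longleftrightarrow>
    m = n \<and> Gam m A = Gam n B \<and> (\<forall>\<gamma>\<in>Gam m A. t_aut l (f \<gamma>) = smult (l ^ \<gamma>) (f' \<gamma>))"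
    (is "_ \<longleftrightarrow> ?R")
proof
  note sub = subalgebraD[OF alg_class_subalgebra[OF B]]
  assume eq: "t_aut l ` A = B"
  then have n: "n = m" using alg_class_image_t_aut[OF A l] B alg_class_unique by blast
  have G: "Gam m B = Gam m A"
    using Gam_image_t_aut[OF l alg_class_subalgebra[OF A]] eq by blast
  have "t_aut l (f \<gamma>) = smult (l ^ \<gamma>) (f' \<gamma>)" if \<gamma>: "\<gamma> \<in> Gam m A" for \<gamma>
  proof -
    \<comment> \<open>Both terms lie in \<open>B\<close>, have coefficient \<lambda>^\<gamma> at
      \<gamma> and vanish at all other exponents that are not gaps above \<gamma>; hence
      \<open>d\<close> is supported on gaps.\<close>
    define d where "d = t_aut l (f \<gamma>) - smult (l ^ \<gamma>) (f' \<gamma>)"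
    have "t_aut l (f \<gamma>) \<in> B" using canonical_basis_mem[OF A bA \<gamma>] eq by blast
    moreover have "f' \<gamma> \<in> B" using canonical_basis_mem[OF B bB] \<gamma> G n by simp
    ultimately have "d \<in> B" unfolding d_def by (intro sub(4) sub(6))
    moreover have "i \<in> CGam m B \<gamma>" if "coeff d i \<noteq> 0" for i
    proof (rule ccontr)
      assume i: "i \<notin> CGam m B \<gamma>"
      then have "coeff (f \<gamma>) i = (if i = \<gamma> then 1 else 0)"
        by (intro canonical_basis_coeff[OF bA \<gamma>]) (simp add: CGam_def G)
      moreover have "coeff (f' \<gamma>) i = (if i = \<gamma> then 1 else 0)"
        using i \<gamma> by (intro canonical_basis_coeff[OF bB]) (simp_all add: G n)
      ultimately show False using that by (auto simp: d_def split: if_splits)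
    qed
    ultimately have "d = 0" by (rule eq_0_if_support_subset_CGam[OF alg_class_subalgebra[OF B]])
    then show ?thesis by (simp add: d_def)
  qed
  with n G show ?R by simp
next
  assume R: ?R
  then have B': "B \<in> alg_class m" and bB': "canonical_basis m B f' u'"
    and G: "Gam m B = Gam m A" using B bB by auto
  have "t_aut l ` A \<subseteq> B"
    using R canonical_basis_mem[OF B' bB'] G subalgebraD(6)[OF alg_class_subalgebra[OF B']]
    by (intro image_t_aut_subset[OF A B' bA]) simp
  moreover have "t_aut (inverse l) ` B \<subseteq> A"
  proof (rule image_t_aut_subset[OF B' A bB'])
    fix \<gamma> assume "\<gamma> \<in> Gam m B"
    with R G have \<gamma>: "\<gamma> \<in> Gam m A" "t_aut l (f \<gamma>) = smult (l ^ \<gamma>) (f' \<gamma>)" by simp_all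
    from \<gamma>(2) have "f' \<gamma> = smult (inverse l ^ \<gamma>) (t_aut l (f \<gamma>))"
      using l by (simp add: power_inverse)
    then have "t_aut (inverse l) (f' \<gamma>) = smult (inverse l ^ \<gamma>) (f \<gamma>)"
      using l by (simp add: t_aut_smult)
    then show "t_aut (inverse l) (f' \<gamma>) \<in> A"
      using subalgebraD(6)[OF alg_class_subalgebra[OF A] canonical_basis_mem[OF A bA \<gamma>(1)]] by simp
  qed
  then have "t_aut l ` t_aut (inverse l) ` B \<subseteq> t_aut l ` A" by (rule image_mono)
  then have "B \<subseteq> t_aut l ` A" using l by (simp add: image_image)
  ultimately show "t_aut l ` A = B" by (rule equalityI)
qed

text \<open>By f = x^\<gamma> u on both sides, the two equations differ by the nonzero factor
  \<lambda>^\<gamma> x^\<gamma>.\<close>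

lemma t_aut_f_iff_t_aut_u:
  assumes "canonical_basis m A f u" "canonical_basis n B f' u'" "l \<noteq> 0"
    and "\<gamma> \<in> Gam m A" "\<gamma> \<in> Gam n B"
  shows "t_aut l (f \<gamma>) = smult (l ^ \<gamma>) (f' \<gamma>) \<longleftrightarrow> t_aut l (u \<gamma>) = u' \<gamma>"
proof -
  have "t_aut l (f \<gamma>) = monom (l ^ \<gamma>) \<gamma> * t_aut l (u \<gamma>)"
    using canonical_basis_f_u[OF assms(1,4)] by (simp add: t_aut_mult t_aut_monom)
  moreover have "smult (l ^ \<gamma>) (f' \<gamma>) = monom (l ^ \<gamma>) \<gamma> * u' \<gamma>"
    using canonical_basis_f_u[OF assms(2,5)] by (simp add: smult_monom_mult)
  ultimately show ?thesis using assms(3) by simp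
qed

lemma image_t_aut_eq_iff_canonical_basis_u:
  assumes "A \<in> alg_class m" "B \<in> alg_class n" "canonical_basis m A f u" "canonical_basis n B f' u'" "l \<noteq> 0"
  shows "t_aut l ` A = B \<longleftrightarrow>
    m = n \<and> Gam m A = Gam n B \<and> (\<forall>\<gamma>\<in>Gam m A. t_aut l (u \<gamma>) = u' \<gamma>)"
  using image_t_aut_eq_iff_canonical_basis[OF assms] t_aut_f_iff_t_aut_u[OF assms(3,4,5)] by auto

section \<open>Torus orbits\<close>

lemma torus_transporter_eq:
  assumes "\<And>l. l \<noteq> 0 \<Longrightarrow> t_aut l ` A = B \<longleftrightarrow> P l"
  shows "{t_aut l | l. l \<noteq> 0 \<and> P l} = {t \<in> torus. t ` A = B}"
  using assms by (auto simp: torus_def)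

lemma torus_orbit_eq:
  assumes "m \<ge> 2" "A \<in> alg_class m"
  shows "torus_orbit A = {B. (\<exists>n\<ge>2. B \<in> alg_class n) \<and> alg_iso A B}"
proof (intro equalityI subsetI)
  fix B assume "B \<in> torus_orbit A"
  then obtain l where l: "l \<noteq> 0" "B = t_aut l ` A" by (auto simp: torus_orbit_def)
  then have "B \<in> alg_class m" using alg_class_image_t_aut[OF assms(2)] by simp
  with l show "B \<in> {B. (\<exists>n\<ge>2. B \<in> alg_class n) \<and> alg_iso A B}"
    using alg_iso_iff_torus[OF assms(2)] assms(1) by blast
next
  fix B assume "B \<in> {B. (\<exists>n\<ge>2. B \<in> alg_class n) \<and> alg_iso A B}"
  then show "B \<in> torus_orbit A"
    using alg_iso_iff_torus[OF assms(2), of B] unfolding torus_orbit_def by blast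
qed

lemma image_torus_coset:
  assumes A: "A \<in> alg_class m" and "t \<in> torus_coset l A"
  shows "t ` A = t_aut l ` A"
proof -
  obtain s where "t = t_aut l \<circ> s" "s ` A = A"
    using assms by (auto simp: torus_coset_def torus_Aut_eq[OF A])
  then show ?thesis by (metis image_comp)
qed

lemma t_aut_in_torus_coset:
  assumes A: "A \<in> alg_class m" and "l \<noteq> 0"
  shows "t_aut l \<in> torus_coset l A"
proof -
  have "t_aut l = t_aut l \<circ> t_aut 1" by (simp add: fun_eq_iff)
  moreover have "t_aut 1 \<in> torus_Aut A"
    unfolding torus_Aut_eq[OF A] torus_def by auto
  ultimately show ?thesis unfolding torus_coset_def by blast
qed

text \<open>The cosets of the stabilizer of \<open>A\<close> are the fibres of the orbit map, which
  gives injectivity in the orbit-stabilizer bijection.\<close>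

lemma torus_coset_eq:
  assumes A: "A \<in> alg_class m" and "l \<noteq> 0"
  shows "torus_coset l A = {t \<in> torus. t ` A = t_aut l ` A}"
proof (intro equalityI subsetI)
  fix t assume t: "t \<in> torus_coset l A"
  then obtain k where "t = t_aut l \<circ> t_aut k" "k \<noteq> 0"
    by (auto simp: torus_coset_def torus_Aut_eq[OF A] torus_def)
  then have "t = t_aut (l * k)" "l * k \<noteq> 0" using assms(2) by (auto simp: fun_eq_iff t_aut_t_aut)
  then show "t \<in> {t \<in> torus. t ` A = t_aut l ` A}"
    using image_torus_coset[OF A t] by (auto simp: torus_def)
next
  fix t assume "t \<in> {t \<in> torus. t ` A = t_aut l ` A}"
  then obtain k where k: "t = t_aut k" "k \<noteq> 0" "t_aut k ` A = t_aut l ` A" by (auto simp: torus_def)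
  have "t_aut (inverse l * k) ` A = A"
    using image_t_aut_eq_iff[OF assms(2), of A "t_aut k ` A"] k(3)
    unfolding image_t_aut_image by simp
  then have "t_aut (inverse l * k) \<in> torus_Aut A"
    using k(2) assms(2) by (auto simp: torus_Aut_eq[OF A] torus_def)
  moreover have "t = t_aut l \<circ> t_aut (inverse l * k)"
    using assms(2) by (simp add: k(1) fun_eq_iff t_aut_t_aut flip: mult.assoc)
  ultimately show "t \<in> torus_coset l A" by (auto simp: torus_coset_def)
qed

lemma torus_mod_Aut_bij_orbit:
  assumes A: "A \<in> alg_class m"
  shows "\<exists>\<Phi>. bij_betw \<Phi> (torus_mod_Aut A) (torus_orbit A) \<and>
    (\<forall>l. l \<noteq> 0 \<longrightarrow> \<Phi> (torus_coset l A) = t_aut l ` A)"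
proof -
  \<comment> \<open>All members of a coset send \<open>A\<close> to the same algebra, so the union
    is that algebra and no representative has to be chosen.\<close>
  define \<Phi> where "\<Phi> C = (\<Union>t\<in>C. t ` A)" for C :: "('a poly \<Rightarrow> 'a poly) set"
  have \<Phi>: "\<Phi> (torus_coset l A) = t_aut l ` A" if "l \<noteq> 0" for l
  proof -
    have "\<Phi> (torus_coset l A) = (\<Union>t\<in>torus_coset l A. t_aut l ` A)"
      unfolding \<Phi>_def using image_torus_coset[OF A] by (intro SUP_cong) auto
    also have "\<dots> = t_aut l ` A" using t_aut_in_torus_coset[OF A that] by auto
    finally show ?thesis .
  qed
  have "inj_on \<Phi> (torus_mod_Aut A)"
  proof (rule inj_onI)
    fix C D assume "C \<in> torus_mod_Aut A" "D \<in> torus_mod_Aut A" and eq: "\<Phi> C = \<Phi> D"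
    then obtain k l where kl: "C = torus_coset k A" "D = torus_coset l A" "k \<noteq> 0" "l \<noteq> 0"
      by (auto simp: torus_mod_Aut_def)
    with eq have "t_aut k ` A = t_aut l ` A" by (simp add: \<Phi>)
    with kl show "C = D" by (simp add: torus_coset_eq[OF A])
  qed
  moreover have "\<Phi> ` torus_mod_Aut A = torus_orbit A"
    unfolding torus_mod_Aut_def torus_orbit_def using \<Phi> by (auto simp: image_Collect)
  ultimately show ?thesis using \<Phi> by (auto simp: bij_betw_def)
qed

theorem theorem3p1:
  fixes A A' :: "'a::field poly set" and m m' :: nat
    and f u f' u' :: "nat \<Rightarrow> 'a poly"
  assumes "m \<ge> 2" and "m' \<ge> 2"
    and "A \<in> alg_class m" and "A' \<in> alg_class m'"
    and "canonical_basis m A f u" and "canonical_basis m' A' f' u'"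
  shows
    "bij_betw (\<lambda>t. restrict t A) {t \<in> torus. t ` A = A'} (Iso_K A A') \<and>
     (alg_iso A A' \<longleftrightarrow>
        m = m' \<and> Gam m A = Gam m' A' \<and>
        (\<exists>l. l \<noteq> 0 \<and> (\<forall>\<gamma>\<in>Gam m A. t_aut l (f \<gamma>) = smult (l ^ \<gamma>) (f' \<gamma>)))) \<and>
     (alg_iso A A' \<longleftrightarrow>
        m = m' \<and> Gam m A = Gam m' A' \<and>
        (\<exists>l. l \<noteq> 0 \<and> (\<forall>\<gamma>\<in>Gam m A. t_aut l (u \<gamma>) = u' \<gamma>))) \<and>
     (alg_iso A A' \<longrightarrow>
        (Gam m A = Gam m' A' \<and>
         bij_betw (\<lambda>t. restrict t A)
           {t_aut l | l. l \<noteq> 0 \<and> (\<forall>\<gamma>\<in>Gam m A. t_aut l (f \<gamma>) = smult (l ^ \<gamma>) (f' \<gamma>))}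
           (Iso_K A A') \<and>
         bij_betw (\<lambda>t. restrict t A)
           {t_aut l | l. l \<noteq> 0 \<and> (\<forall>\<gamma>\<in>Gam m A. t_aut l (u \<gamma>) = u' \<gamma>)}
           (Iso_K A A')) \<and>
        (torus_orbit A = {B. (\<exists>n\<ge>2. B \<in> alg_class n) \<and> alg_iso A B} \<and>
         bij_betw (\<lambda>t. restrict t A) (torus_Aut A) (Aut_K A) \<and>
         torus_Aut A = {t_aut l | l. l \<noteq> 0 \<and> (\<forall>\<gamma>\<in>Gam m A. t_aut l (u \<gamma>) = u \<gamma>)} \<and>
         (\<exists>\<Phi>. bij_betw \<Phi> (torus_mod_Aut A) (torus_orbit A) \<and>
              (\<forall>l. l \<noteq> 0 \<longrightarrow> \<Phi> (torus_coset l A) = t_aut l ` A))))"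
proof -
  note A = assms(3) and B = assms(4) and bA = assms(5) and bB = assms(6)
  note by_f = image_t_aut_eq_iff_canonical_basis[OF A B bA bB]
    and by_u = image_t_aut_eq_iff_canonical_basis_u[OF A B bA bB]
    and self_u = image_t_aut_eq_iff_canonical_basis_u[OF A A bA bA]
  have iso: "alg_iso A A' \<longleftrightarrow> (\<exists>l. l \<noteq> 0 \<and> t_aut l ` A = A')"
    by (rule alg_iso_iff_torus[OF A B])
  have absorb: "P \<and> Q \<and> X \<longleftrightarrow> X" if "P" "Q" for P Q X
    using that by simp
  \<comment> \<open>The conditions on m and \<Gamma> do not involve \<lambda>, so they move out of
    the existential quantifier.\<close>
  have ex_absorb: "(\<exists>l. l \<noteq> 0 \<and> R l) \<longleftrightarrow> P \<and> Q \<and> (\<exists>l. l \<noteq> 0 \<and> X l)"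
    if "\<And>l. l \<noteq> 0 \<Longrightarrow> R l \<longleftrightarrow> P \<and> Q \<and> X l" for P Q and R X :: "'a \<Rightarrow> bool"
    using that by blast
  have iso_f: "alg_iso A A' \<longleftrightarrow> m = m' \<and> Gam m A = Gam m' A' \<and>
      (\<exists>l. l \<noteq> 0 \<and> (\<forall>\<gamma>\<in>Gam m A. t_aut l (f \<gamma>) = smult (l ^ \<gamma>) (f' \<gamma>)))"
    and iso_u: "alg_iso A A' \<longleftrightarrow> m = m' \<and> Gam m A = Gam m' A' \<and>
      (\<exists>l. l \<noteq> 0 \<and> (\<forall>\<gamma>\<in>Gam m A. t_aut l (u \<gamma>) = u' \<gamma>))"
    unfolding iso by (rule ex_absorb, erule by_f, rule ex_absorb, erule by_u)
  have m: "m = m'" and G: "Gam m A = Gam m' A'" if "alg_iso A A'"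
    using that unfolding iso_f by (rule conjunct1, elim conjE)
  have set_f: "{t_aut l | l. l \<noteq> 0 \<and> (\<forall>\<gamma>\<in>Gam m A. t_aut l (f \<gamma>) = smult (l ^ \<gamma>) (f' \<gamma>))}
        = {t \<in> torus. t ` A = A'}"
    and set_u: "{t_aut l | l. l \<noteq> 0 \<and> (\<forall>\<gamma>\<in>Gam m A. t_aut l (u \<gamma>) = u' \<gamma>)}
        = {t \<in> torus. t ` A = A'}"
    if "alg_iso A A'"
    by (rule torus_transporter_eq, rule trans[OF _ absorb[OF m[OF that] G[OF that]]], erule by_f,
        rule torus_transporter_eq, rule trans[OF _ absorb[OF m[OF that] G[OF that]]], erule by_u)
  have bij: "bij_betw (\<lambda>t. restrict t A) {t \<in> torus. t ` A = A'} (Iso_K A A')"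
    by (rule bij_betw_restrict_Iso_K[OF A B])
  have bij_f: "bij_betw (\<lambda>t. restrict t A)
      {t_aut l | l. l \<noteq> 0 \<and> (\<forall>\<gamma>\<in>Gam m A. t_aut l (f \<gamma>) = smult (l ^ \<gamma>) (f' \<gamma>))} (Iso_K A A')"
    and bij_u: "bij_betw (\<lambda>t. restrict t A)
      {t_aut l | l. l \<noteq> 0 \<and> (\<forall>\<gamma>\<in>Gam m A. t_aut l (u \<gamma>) = u' \<gamma>)} (Iso_K A A')"
    if "alg_iso A A'"
    unfolding set_f[OF that] set_u[OF that] by (rule bij)+
  have aut: "torus_Aut A = {t_aut l | l. l \<noteq> 0 \<and> (\<forall>\<gamma>\<in>Gam m A. t_aut l (u \<gamma>) = u \<gamma>)}"
    unfolding torus_Aut_eq[OF A] using self_u by (intro torus_transporter_eq[symmetric]) simp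
  have bij_aut: "bij_betw (\<lambda>t. restrict t A) (torus_Aut A) (Aut_K A)"
    unfolding torus_Aut_eq[OF A] by (rule bij_betw_restrict_Iso_K[OF A A])
  show ?thesis
    by (intro conjI impI bij iso_f iso_u G bij_f bij_u torus_orbit_eq[OF assms(1) A] bij_aut aut
        torus_mod_Aut_bij_orbit[OF A])
qed

end
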